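(* Let $I\subseteq\mathbb{R}$ be an open invex subset with respect to $\eta:I\times I\to\mathbb{R}_+$, let $f:I\to\mathbb{R}$ be an absolutely continuous mapping on $I$, and let $a,b\in I$ with $\eta(b,a)\neq 0$. If $|f'|$ is preinvex on $I$ with respect to $\eta$, then $$\left|\frac{1}{6}\left[f(a)+4f\left(\frac{2a+\eta(b,a)}{2}\right)+f(a+\eta(b,a))\right]-\frac{1}{\eta(b,a)}\int_a^{a+\eta(b,a)}f(x)\,dx\right|\le\frac{5}{72}\,\eta(b,a)\left[|f'(a)|+|f'(b)|\right].$$
   Context: $\mathbb{R}_+=[0,\infty)$. A set $I\subseteq\mathbb{R}$ is invex with respect to $\eta:I\times I\to\mathbb{R}_+$ if $u+t\,\eta(v,u)\in I$ for all $u,v\in I$ and all $t\in[0,1]$. A function $g:I\to\mathbb{R}$ on an invex set $I$ is preinvex with respect to $\eta$ if $g(u+t\,\eta(v,u))\le(1-t)g(u)+t\,g(v)$ for all $u,v\in I$, $t\in[0,1]$. $f'$ is the derivative of $f$; the hypothesis that $|f'|$ is preinvex on $I$ presupposes that $f'(x)$ exists at every $x\in I$. *)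

theory Defs
  imports "HOL-Analysis.Analysis"
begin

text \<open>A map \<open>\<eta> : I \<times> I \<rightarrow> [0, \<infinity>)\<close> is represented by a curried total function; only its values
  on \<open>I\<close> matter, and its nonnegativity there is part of invexity.\<close>

definition invex :: "real set \<Rightarrow> (real \<Rightarrow> real \<Rightarrow> real) \<Rightarrow> bool" where
  "invex I \<eta> \<longleftrightarrow>
     (\<forall>u\<in>I. \<forall>v\<in>I. 0 \<le> \<eta> v u) \<and>
     (\<forall>u\<in>I. \<forall>v\<in>I. \<forall>t\<in>{0..1}. u + t * \<eta> v u \<in> I)"

definition preinvex_on :: "real set \<Rightarrow> (real \<Rightarrow> real \<Rightarrow> real) \<Rightarrow> (real \<Rightarrow> real) \<Rightarrow> bool" where
  "preinvex_on I \<eta> g \<longleftrightarrow>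
     (\<forall>u\<in>I. \<forall>v\<in>I. \<forall>t\<in>{0..1}. g (u + t * \<eta> v u) \<le> (1 - t) * g u + t * g v)"

text \<open>Absolute continuity of a function on a set of reals, in the \<open>\<epsilon>\<close>-\<open>\<delta>\<close> sense, which is unrelated to
  the library's absolute continuity of measures. A pair \<open>(x, y)\<close> in \<open>P\<close> encodes the interval from
  \<open>x\<close> to \<open>y\<close>. As \<open>I\<close> need not be an interval, the whole of \<open>{x..y}\<close> has to lie in \<open>I\<close>.\<close>

definition abs_continuous_on :: "real set \<Rightarrow> (real \<Rightarrow> real) \<Rightarrow> bool" where
  "abs_continuous_on I f \<longleftrightarrow>
     (\<forall>\<epsilon>>0. \<exists>\<delta>>0. \<forall>P.
        finite P \<and>
        (\<forall>(x, y)\<in>P. x < y \<and> {x..y} \<subseteq> I) \<and>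
        pairwise (\<lambda>p q. disjnt {fst p<..<snd p} {fst q<..<snd q}) P \<and>
        (\<Sum>(x, y)\<in>P. y - x) < \<delta>
        \<longrightarrow> (\<Sum>(x, y)\<in>P. \<bar>f y - f x\<bar>) < \<epsilon>)"

end

theory Submission
  imports Defs
begin

text \<open>Write \<open>h = \<eta> b a\<close>. Integration by parts on the two halves of \<open>{a..a + h}\<close>, with a linear kernel
  on each half, turns the error of Simpson's rule into an integral of the kernel against \<open>f'\<close>:
  the kernel is \<open>x - (a + h/6)\<close> on the left half and \<open>x - (a + 5h/6)\<close> on the right half, the two zeros
  being chosen so that the boundary terms produce the weights \<open>h/6\<close>, \<open>h/3 + h/3\<close>, \<open>h/6\<close>.
  Preinvexity, applied at \<open>x = a + t * h\<close>, bounds \<open>\<bar>f'\<bar>\<close> on the whole interval by the affine function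
  that interpolates \<open>\<bar>f'(a)\<bar>\<close> at \<open>a\<close> and \<open>\<bar>f'(b)\<bar>\<close> at \<open>a + h\<close>. The absolute value of the kernel
  is symmetric about the midpoint and has integral \<open>5 * h\<^sup>2 / 36\<close>, so against this affine bound it
  gives that integral times the mean of the end values, which is \<open>h\<close> times the claim.

  The integration by parts and the estimate on one half are \<open>linear_kernel_error_bound\<close>, which is used
  once for each half. The kernel times \<open>f'\<close> is the derivative of the kernel times \<open>f\<close>, minus the
  continuous function \<open>f\<close>, and is therefore Henstock--Kurzweil integrable.\<close>

lemma has_integral_linear_kernel_by_parts:
  fixes f f' :: "real \<Rightarrow> real"
  assumes "c \<le> d" and deriv: "\<And>x. x \<in> {c..d} \<Longrightarrow> (f has_real_derivative f' x) (at x)"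
  shows "((\<lambda>x. (x - m) * f' x) has_integral
           (d - m) * f d - (c - m) * f c - integral {c..d} f) {c..d}"
proof -
  have "((\<lambda>x. f x + (x - m) * f' x) has_integral (d - m) * f d - (c - m) * f c) {c..d}"
  proof (rule fundamental_theorem_of_calculus[OF \<open>c \<le> d\<close>])
    fix x assume "x \<in> {c..d}"
    then have "((\<lambda>x. (x - m) * f x) has_real_derivative f x + (x - m) * f' x) (at x)"
      by (auto intro!: derivative_eq_intros deriv)
    then show "((\<lambda>x. (x - m) * f x) has_vector_derivative f x + (x - m) * f' x)
        (at x within {c..d})"
      by (metis has_real_derivative_iff_has_vector_derivative has_vector_derivative_at_within)
  qed
  moreover have "continuous_on {c..d} f"
    using deriv by (meson DERIV_isCont continuous_at_imp_continuous_on)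
  then have "(f has_integral integral {c..d} f) {c..d}"
    by (intro integrable_integral integrable_continuous_real)
  ultimately have "((\<lambda>x. f x + (x - m) * f' x - f x) has_integral
      (d - m) * f d - (c - m) * f c - integral {c..d} f) {c..d}"
    by (rule has_integral_diff)
  then show ?thesis
    by (simp only: add_diff_cancel_left')
qed

lemma has_integral_abs_kernel_times_affine:
  fixes c d m :: real
  assumes "c \<le> m" and "m \<le> d"
  shows "((\<lambda>x. \<bar>x - m\<bar> * (\<alpha> + \<beta> * (x - m))) has_integral
           \<alpha> * ((d - m)^2 + (m - c)^2) / 2 + \<beta> * ((d - m)^3 - (m - c)^3) / 3) {c..d}"
proof -
  define F where "F x = \<alpha> * (x - m)^2 / 2 + \<beta> * (x - m)^3 / 3" for x
  have F: "(F has_vector_derivative (x - m) * (\<alpha> + \<beta> * (x - m))) (at x within S)" for x S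
  proof -
    have "(F has_real_derivative (x - m) * (\<alpha> + \<beta> * (x - m))) (at x within S)"
      unfolding F_def by (auto intro!: derivative_eq_intros simp: power2_eq_square field_simps)
    then show ?thesis
      by (simp add: has_real_derivative_iff_has_vector_derivative)
  qed
  have "((\<lambda>x. (x - m) * (\<alpha> + \<beta> * (x - m))) has_integral F d - F m) {m..d}"
    using fundamental_theorem_of_calculus[OF \<open>m \<le> d\<close> F] .
  then have right: "((\<lambda>x. \<bar>x - m\<bar> * (\<alpha> + \<beta> * (x - m))) has_integral F d - F m) {m..d}"
    by (rule has_integral_eq[rotated]) simp
  have "((\<lambda>x. (x - m) * (\<alpha> + \<beta> * (x - m))) has_integral F m - F c) {c..m}"
    using fundamental_theorem_of_calculus[OF \<open>c \<le> m\<close> F] .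
  then have "((\<lambda>x. - ((x - m) * (\<alpha> + \<beta> * (x - m)))) has_integral - (F m - F c)) {c..m}"
    by (rule has_integral_neg)
  then have left: "((\<lambda>x. \<bar>x - m\<bar> * (\<alpha> + \<beta> * (x - m))) has_integral - (F m - F c)) {c..m}"
    by (rule has_integral_eq[rotated]) (simp add: algebra_simps)
  have "- (F m - F c) + (F d - F m)
      = \<alpha> * ((d - m)^2 + (m - c)^2) / 2 + \<beta> * ((d - m)^3 - (m - c)^3) / 3"
    unfolding F_def by (simp add: field_simps power2_eq_square power3_eq_cube)
  then show ?thesis
    using has_integral_combine[OF assms left right] by (simp only:)
qed

text \<open>The kernel \<open>x - m\<close> produces the quadrature rule with weights \<open>m - c\<close> at \<open>c\<close> and \<open>d - m\<close> at \<open>d\<close>,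
  so a choice of \<open>m\<close> is a choice of weights. The bound on \<open>\<bar>f'\<bar>\<close> is centred at \<open>m\<close> because it is
  multiplied by \<open>\<bar>x - m\<bar>\<close>.\<close>
lemma linear_kernel_error_bound:
  fixes f f' :: "real \<Rightarrow> real"
  assumes "c \<le> m" and "m \<le> d"
    and deriv: "\<And>x. x \<in> {c..d} \<Longrightarrow> (f has_real_derivative f' x) (at x)"
    and bound: "\<And>x. x \<in> {c..d} \<Longrightarrow> \<bar>f' x\<bar> \<le> \<alpha> + \<beta> * (x - m)"
  shows "\<bar>(m - c) * f c + (d - m) * f d - integral {c..d} f\<bar>
       \<le> \<alpha> * ((d - m)^2 + (m - c)^2) / 2 + \<beta> * ((d - m)^3 - (m - c)^3) / 3"
proof -
  have "c \<le> d" using assms by simp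
  have parts: "((\<lambda>x. (x - m) * f' x) has_integral
      (d - m) * f d - (c - m) * f c - integral {c..d} f) {c..d}"
    using \<open>c \<le> d\<close> deriv by (rule has_integral_linear_kernel_by_parts)
  note affine = has_integral_abs_kernel_times_affine[OF assms(1,2), of \<alpha> \<beta>]
  have "norm (integral {c..d} (\<lambda>x. (x - m) * f' x))
      \<le> integral {c..d} (\<lambda>x. \<bar>x - m\<bar> * (\<alpha> + \<beta> * (x - m)))"
  proof (rule integral_norm_bound_integral)
    show "(\<lambda>x. (x - m) * f' x) integrable_on {c..d}"
      using parts by blast
    show "(\<lambda>x. \<bar>x - m\<bar> * (\<alpha> + \<beta> * (x - m))) integrable_on {c..d}"
      using affine by blast
    show "norm ((x - m) * f' x) \<le> \<bar>x - m\<bar> * (\<alpha> + \<beta> * (x - m))" if "x \<in> {c..d}" for x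
      using bound[OF that] by (simp add: abs_mult mult_left_mono)
  qed
  then have "\<bar>(d - m) * f d - (c - m) * f c - integral {c..d} f\<bar>
      \<le> \<alpha> * ((d - m)^2 + (m - c)^2) / 2 + \<beta> * ((d - m)^3 - (m - c)^3) / 3"
    unfolding integral_unique[OF parts] integral_unique[OF affine] real_norm_def .
  moreover have "(d - m) * f d - (c - m) * f c = (m - c) * f c + (d - m) * f d"
    by (simp add: algebra_simps)
  ultimately show ?thesis
    by (simp only:)
qed

text \<open>The two kernels are mirror images of each other, so the cubic terms of the two halves cancel
  and the quadratic terms carry the same factor. That factor multiplies the values of the affine
  bound at the zeros of the kernels, which add up to \<open>p + q\<close>.\<close>
lemma simpson_error_bound_affine_derivative:
  fixes f f' :: "real \<Rightarrow> real"
  assumes "0 < h"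
    and deriv: "\<And>x. x \<in> {a..a + h} \<Longrightarrow> (f has_real_derivative f' x) (at x)"
    and bound: "\<And>t. t \<in> {0..1} \<Longrightarrow> \<bar>f' (a + t * h)\<bar> \<le> (1 - t) * p + t * q"
  shows "\<bar>1 / 6 * (f a + 4 * f (a + h / 2) + f (a + h)) - 1 / h * integral {a..a + h} f\<bar>
       \<le> 5 / 72 * h * (p + q)"
proof -
  define \<beta> where "\<beta> = (q - p) / h"
  \<comment> \<open>One affine bound, recentred: \<open>s\<close> will be \<open>1/6\<close> and \<open>5/6\<close>, so that \<open>a + s * h\<close> is the zero of a kernel.\<close>
  have affine: "\<bar>f' x\<bar> \<le> p + s * (q - p) + \<beta> * (x - (a + s * h))" if "x \<in> {a..a + h}" for x s
  proof -
    define t where "t = (x - a) / h"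
    have x: "x = a + t * h" and "t \<in> {0..1}"
      using that \<open>0 < h\<close> unfolding t_def by (simp_all add: divide_le_eq)
    have "\<beta> * h = q - p"
      using \<open>0 < h\<close> unfolding \<beta>_def by simp
    have "\<bar>f' x\<bar> \<le> (1 - t) * p + t * q"
      unfolding x by (rule bound[OF \<open>t \<in> {0..1}\<close>])
    also have "\<dots> = p + s * (q - p) + (t - s) * (q - p)"
      by (simp add: algebra_simps)
    also have "\<dots> = p + s * (q - p) + \<beta> * (x - (a + s * h))"
      unfolding x \<open>\<beta> * h = q - p\<close>[symmetric] by (simp add: algebra_simps)
    finally show ?thesis .
  qed
  have left: "\<bar>h / 6 * f a + h / 3 * f (a + h / 2) - integral {a..a + h / 2} f\<bar>
      \<le> (p + 1 / 6 * (q - p)) * ((h / 3)^2 + (h / 6)^2) / 2 + \<beta> * ((h / 3)^3 - (h / 6)^3) / 3"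
  proof -
    define m where "m = a + 1 / 6 * h"
    have m: "m - a = h / 6" "a + h / 2 - m = h / 3" "a \<le> m" "m \<le> a + h / 2"
      using \<open>0 < h\<close> unfolding m_def by linarith+
    have "\<bar>(m - a) * f a + (a + h / 2 - m) * f (a + h / 2) - integral {a..a + h / 2} f\<bar>
        \<le> (p + 1 / 6 * (q - p)) * ((a + h / 2 - m)^2 + (m - a)^2) / 2
          + \<beta> * ((a + h / 2 - m)^3 - (m - a)^3) / 3"
    proof (rule linear_kernel_error_bound[OF m(3,4)])
      fix x assume "x \<in> {a..a + h / 2}"
      then have "x \<in> {a..a + h}" using \<open>0 < h\<close> by auto
      then show "(f has_real_derivative f' x) (at x)"
        and "\<bar>f' x\<bar> \<le> p + 1 / 6 * (q - p) + \<beta> * (x - m)"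
        unfolding m_def by (fact deriv, fact affine)
    qed
    then show ?thesis unfolding m(1,2) .
  qed
  have right: "\<bar>h / 3 * f (a + h / 2) + h / 6 * f (a + h) - integral {a + h / 2..a + h} f\<bar>
      \<le> (p + 5 / 6 * (q - p)) * ((h / 6)^2 + (h / 3)^2) / 2 + \<beta> * ((h / 6)^3 - (h / 3)^3) / 3"
  proof -
    define m where "m = a + 5 / 6 * h"
    have m: "m - (a + h / 2) = h / 3" "a + h - m = h / 6" "a + h / 2 \<le> m" "m \<le> a + h"
      using \<open>0 < h\<close> unfolding m_def by linarith+
    have "\<bar>(m - (a + h / 2)) * f (a + h / 2) + (a + h - m) * f (a + h)
          - integral {a + h / 2..a + h} f\<bar>
        \<le> (p + 5 / 6 * (q - p)) * ((a + h - m)^2 + (m - (a + h / 2))^2) / 2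
          + \<beta> * ((a + h - m)^3 - (m - (a + h / 2))^3) / 3"
    proof (rule linear_kernel_error_bound[OF m(3,4)])
      fix x assume "x \<in> {a + h / 2..a + h}"
      then have "x \<in> {a..a + h}" using \<open>0 < h\<close> by auto
      then show "(f has_real_derivative f' x) (at x)"
        and "\<bar>f' x\<bar> \<le> p + 5 / 6 * (q - p) + \<beta> * (x - m)"
        unfolding m_def by (fact deriv, fact affine)
    qed
    then show ?thesis unfolding m(1,2) .
  qed
  have sum_of_bounds:
    "((p + 1 / 6 * (q - p)) * (u^2 + v^2) / 2 + \<beta> * (u^3 - v^3) / 3)
      + ((p + 5 / 6 * (q - p)) * (v^2 + u^2) / 2 + \<beta> * (v^3 - u^3) / 3)
      = (p + q) * (u^2 + v^2) / 2" for u v :: real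
    by (simp add: field_simps)
  have "continuous_on {a..a + h} f"
    using deriv by (meson DERIV_isCont continuous_at_imp_continuous_on)
  then have "integral {a..a + h / 2} f + integral {a + h / 2..a + h} f = integral {a..a + h} f"
    using \<open>0 < h\<close>
    by (intro Henstock_Kurzweil_Integration.integral_combine integrable_continuous_real) auto
  then have halves:
    "h * (1 / 6 * (f a + 4 * f (a + h / 2) + f (a + h)) - 1 / h * integral {a..a + h} f)
      = (h / 6 * f a + h / 3 * f (a + h / 2) - integral {a..a + h / 2} f)
      + (h / 3 * f (a + h / 2) + h / 6 * f (a + h) - integral {a + h / 2..a + h} f)"
    (is "h * ?error = ?L + ?R")
    using \<open>0 < h\<close> by (simp add: algebra_simps)
  have "h * \<bar>?error\<bar> = \<bar>?L + ?R\<bar>"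
    using \<open>0 < h\<close> unfolding halves[symmetric] by (simp only: abs_mult abs_of_pos)
  also have "\<dots> \<le> (p + q) * ((h / 3)^2 + (h / 6)^2) / 2"
    using order.trans[OF abs_triangle_ineq add_mono[OF left right]] unfolding sum_of_bounds .
  also have "\<dots> = h * (5 / 72 * h * (p + q))"
    by (simp add: power2_eq_square field_simps)
  finally show ?thesis
    using \<open>0 < h\<close> by (rule mult_left_le_imp_le)
qed

theorem theorem1:
  fixes I :: "real set" and \<eta> :: "real \<Rightarrow> real \<Rightarrow> real" and f :: "real \<Rightarrow> real" and a b :: real
  assumes "open I" and "invex I \<eta>"
    and "abs_continuous_on I f"
    and "a \<in> I" and "b \<in> I" and "\<eta> b a \<noteq> 0"
    and "\<forall>x\<in>I. f differentiable (at x)"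
    and "preinvex_on I \<eta> (\<lambda>x. \<bar>deriv f x\<bar>)"
  shows "\<bar>1 / 6 * (f a + 4 * f ((2 * a + \<eta> b a) / 2) + f (a + \<eta> b a))
            - 1 / \<eta> b a * integral {a..a + \<eta> b a} f\<bar>
         \<le> 5 / 72 * \<eta> b a * (\<bar>deriv f a\<bar> + \<bar>deriv f b\<bar>)"
proof -
  have pos: "0 < \<eta> b a"
    using assms(2,4-6) unfolding invex_def by (simp add: order.not_eq_order_implies_strict)
  have deriv: "(f has_real_derivative deriv f x) (at x)" if "x \<in> {a..a + \<eta> b a}" for x
  proof -
    have "(x - a) / \<eta> b a \<in> {0..1}" using that pos by simp
    then have "a + (x - a) / \<eta> b a * \<eta> b a \<in> I"
      using assms(2,4,5) unfolding invex_def by blast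
    then have "x \<in> I" using pos by simp
    then show ?thesis
      using assms(7) by (simp add: DERIV_deriv_iff_real_differentiable)
  qed
  have bound: "\<bar>deriv f (a + t * \<eta> b a)\<bar> \<le> (1 - t) * \<bar>deriv f a\<bar> + t * \<bar>deriv f b\<bar>"
    if "t \<in> {0..1}" for t
    using assms(4,5,8) that unfolding preinvex_on_def by blast
  have midpoint: "(2 * a + \<eta> b a) / 2 = a + \<eta> b a / 2"
    by simp
  from simpson_error_bound_affine_derivative[OF pos deriv bound]
  show ?thesis unfolding midpoint .
qed

end
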